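(* For every integer $n\ge 1$, $$ n B_n=\sum_{j=1}^n\bigl(B_j B_{n-j+1}-B_{j-1}B_{n-j}\bigr)\,. $$
   Context: The balancing numbers $B_n$ are defined by $B_0=0$, $B_1=1$ and $B_n=6B_{n-1}-B_{n-2}$ for $n\ge 2$. *)

theory Defs
  imports Main
begin

fun balancing :: "nat \<Rightarrow> int" where
  "balancing 0 = 0"
| "balancing (Suc 0) = 1"
| "balancing (Suc (Suc n)) = 6 * balancing (Suc n) - balancing n"

end

theory Submission
  imports Defs
begin

lemma lucas_sequence_add:
  fixes u v :: "nat \<Rightarrow> 'a::comm_ring_1"
  assumes u_0: "u 0 = 0" and u_1: "u (Suc 0) = 1"
    and u_rec: "\<And>n. u (Suc (Suc n)) = p * u (Suc n) - q * u n"
    and v_rec: "\<And>n. v (Suc (Suc n)) = p * v (Suc n) - q * v n"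
  shows "v (Suc (m + k)) = u (Suc m) * v (Suc k) - q * u m * v k"
proof (induction m arbitrary: k)
  case 0
  show ?case by (simp add: u_0 u_1)
next
  case (Suc m)
  have "v (Suc (Suc m + k)) = u (Suc m) * v (Suc (Suc k)) - q * u m * v (Suc k)"
    using Suc.IH[of "Suc k"] by simp
  also have "\<dots> = (p * u (Suc m) - q * u m) * v (Suc k) - q * u (Suc m) * v k"
    by (simp add: v_rec algebra_simps)
  finally show ?case by (simp add: u_rec)
qed

lemma balancing_add:
  "balancing (Suc (m + k)) = balancing (Suc m) * balancing (Suc k) - balancing m * balancing k"
  using lucas_sequence_add[of balancing 6 1 balancing m k] by simp

theorem theorem1:
  fixes n :: nat
  assumes "n \<ge> 1"
  shows "int n * balancing n =
    (\<Sum>j=1..n. balancing j * balancing (n - j + 1) - balancing (j - 1) * balancing (n - j))"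
proof -
  have summand_eq:
    "balancing j * balancing (n - j + 1) - balancing (j - 1) * balancing (n - j) = balancing n"
    if "j \<in> {1..n}" for j
    using balancing_add[of "j - 1" "n - j"] that by simp
  have "(\<Sum>j=1..n. balancing j * balancing (n - j + 1) - balancing (j - 1) * balancing (n - j))
      = (\<Sum>j=1..n. balancing n)"
    by (intro sum.cong refl summand_eq)
  also have "\<dots> = int n * balancing n" by simp
  finally show ?thesis by (rule sym)
qed

end
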